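(* Let $a\ge 3$ be an integer, and let $(G_n)_{n\ge 0}$ be the sequence defined by the second-order linear recurrence $G_{n+2}=aG_{n+1}-G_n$ for $n\ge 0$, with $G_0=0$ and $G_1=1$. Then for all integers $n\ge 2$, $$\left\lfloor\left(\sum_{k=n}^{\infty}\frac{1}{G_k^3}\right)^{-1}\right\rfloor=\begin{cases} G_n^3-G_{n-1}^3-3\displaystyle\sum_{k=0}^{\lfloor\frac{n-4}{5}\rfloor}G_{n-3-5k}-2, & \text{if } a=3 \text{ and } n\equiv 3\pmod 5,\\[2ex] G_n^3-G_{n-1}^3-3\displaystyle\sum_{k=0}^{\lfloor\frac{n-4}{5}\rfloor}G_{n-3-5k}-1, & \text{otherwise.}\end{cases}$$
   Context: Here $\lfloor x\rfloor$ denotes the greatest integer less than or equal to $x$ (so $\lfloor\frac{n-4}{5}\rfloor=-1$ for $n=2,3$). A sum whose upper limit is $-1$ and lower limit is $0$ is empty and equals $0$. *)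

theory Defs
  imports Complex_Main
begin

end

(* Let q < 1 be the root of q^2 + 1 = a q, so that G_n = q (1 - q^(2n)) / (q^n (1 - q^2)).
   Expanding 1/G_k^3 in powers of q^(2k) and summing gives, up to terms of order q^n,
     1 / sum_{k >= n} 1/G_k^3 = G_n^3 - G_{n-1}^3 - 3 h_n,   h_n = q^(4-n) / ((1 - q^2) (1 - q^5)),
   and the sum of the G_{n-3-5k} is h_n up to a bounded defect that, apart from a term of order q^n,
   depends only on n mod 5.  Thrice the defect lies in (0, 1], except for a = 3 and n = 3 mod 5,
   where it lies in (1, 2].  The expansion is made rigorous by two explicit truncations of the
   tail, whose differences bound 1/G_k^3 from above and from below. *)

theory Submission imports Defs begin

section \<open>Series compared with telescoping differences\<close>

lemma suminf_le_telescope: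
  fixes f Y :: "nat \<Rightarrow> real"
  assumes "\<And>k. 0 \<le> f k" and "\<And>k. f k \<le> Y k - Y (Suc k)" and "Y \<longlonglongrightarrow> 0"
  shows "summable f \<and> suminf f \<le> Y 0"
proof -
  have s: "(\<lambda>k. Y k - Y (Suc k)) sums (Y 0 - 0)"
    using telescope_sums'[OF assms(3)] .
  have "summable f"
    using summable_comparison_test'[OF sums_summable[OF s], of 0 f] assms(1,2) by auto
  then show ?thesis
    using suminf_le[OF assms(2) _ sums_summable[OF s]] sums_unique[OF s] by simp
qed

lemma telescope_le_suminf:
  fixes f Z :: "nat \<Rightarrow> real"
  assumes "summable f" and "\<And>k. Z k - Z (Suc k) \<le> f k" and "Z \<longlonglongrightarrow> 0"
  shows "Z 0 \<le> suminf f"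
proof -
  have s: "(\<lambda>k. Z k - Z (Suc k)) sums (Z 0 - 0)"
    using telescope_sums'[OF assms(3)] .
  show ?thesis
    using suminf_le[OF assms(2) sums_summable[OF s] assms(1)] sums_unique[OF s] by simp
qed

section \<open>The sum of every fifth term\<close>

text \<open>Raising \<open>n\<close> by 5 raises the upper limit by one. The new summand stands at
  \<open>k = 0\<close>, and the others are the old ones with the index shifted. This drives an
  induction in steps of five.\<close>

lemma step_sum_add5:
  fixes G :: "nat \<Rightarrow> int"
  defines "\<sigma> \<equiv> \<lambda>n. \<Sum>k = 0..\<lfloor>(real n - 4) / 5\<rfloor>. G (nat (int n - 3 - 5 * k))"
  shows "\<sigma> (n + 5) = \<sigma> n + G (n + 2)"
proof -
  define K where "K = \<lfloor>(real n - 4) / 5\<rfloor>"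
  have K': "\<lfloor>(real (n + 5) - 4) / 5\<rfloor> = K + 1"
    unfolding K_def by (simp add: diff_divide_distrib add_divide_distrib) linarith
  \<comment> \<open>Since (n - 4)/5 > -1 even for \<open>n = 0\<close>, the new range always
    contains 0, also when the old one is empty (\<open>K = -1\<close>).\<close>
  have "K + 1 \<ge> 0" unfolding K_def using le_floor_iff[of "- 1" "(real n - 4) / 5"] by simp
  then have *: "{0..K + 1} = insert 0 {1..K + 1}" by auto
  have "(\<Sum>k = 1..K + 1. H k) = (\<Sum>k = 0..K. H (k + 1))" for H :: "int \<Rightarrow> int"
    by (rule sum.reindex_bij_witness[of _ "\<lambda>k. k + 1" "\<lambda>k. k - 1"]) auto
  then have "(\<Sum>k = 0..K + 1. H k) = H 0 + (\<Sum>k = 0..K. H (k + 1))" for H :: "int \<Rightarrow> int"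
    unfolding * by simp
  then have "\<sigma> (n + 5) = G (nat (int (n + 5) - 3 - 5 * 0))
      + (\<Sum>k = 0..K. G (nat (int (n + 5) - 3 - 5 * (k + 1))))"
    unfolding \<sigma>_def K' .
  moreover have "(\<Sum>k = 0..K. G (nat (int (n + 5) - 3 - 5 * (k + 1)))) = \<sigma> n"
    unfolding \<sigma>_def K_def by (intro sum.cong refl arg_cong[where f = G]) simp
  moreover have "nat (int (n + 5) - 3 - 5 * 0) = n + 2" by simp
  ultimately show ?thesis by simp
qed

section \<open>Polynomial inequalities behind the telescoping estimates\<close>

text \<open>Both sides agree up to first order in \<open>t\<close>, because e + u = p (1 + q^2) in
  the abbreviations of the proof. Hence their difference is t^2 times a factor whose leading part 3
  e^2 - 9 p^2 q^2 is positive for q \<le> 2/5. With \<open>t = (q ^ k)\<^sup>2\<close> this is the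
  cross-multiplied comparison of 1/G_k^3 with a telescoping difference.\<close>

lemma lower_telescope_poly:
  fixes q t :: real
  assumes q: "0 < q" "q \<le> 2/5" and t: "0 \<le> t" "t \<le> 1/10"
  shows "(1 - q^5 - 3 * (1 - q^3) * t) * (1 - q^5 - 3 * (1 - q^3) * (q\<^sup>2 * t))
    \<le> (1 - t)^3 * (1 - q^5) * (1 - q^5 - 3 * q\<^sup>2 * (1 - q) * t)"
proof -
  define e where "e = 1 - q^5"
  define p where "p = 1 - q^3"
  define u where "u = q\<^sup>2 * (1 - q)"
  have q2: "q\<^sup>2 \<le> (2/5)\<^sup>2" "q^5 \<le> (2/5)^5" using q by (intro power_mono; simp)+
  have e: "e \<ge> 9/10" "e \<le> 1" unfolding e_def using q q2 by (simp_all add: power_divide)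
  have p: "0 \<le> p" "p \<le> 1" unfolding p_def using q by (simp_all add: power_le_one)
  have "0 \<le> u" unfolding u_def using q by simp
  have "u \<le> q\<^sup>2 * 1" unfolding u_def using q by (intro mult_left_mono) auto
  have "p\<^sup>2 * q\<^sup>2 \<le> 1 * (2/5)\<^sup>2" using p q2 by (intro mult_mono) (auto simp: power_le_one)
  moreover have "e\<^sup>2 \<ge> (9/10)\<^sup>2" using e by (intro power_mono) auto
  moreover have "t * (e\<^sup>2 + 9 * e * u) \<le> 1/10 * (1 + 9 * e * u)"
    using t e \<open>0 \<le> u\<close> by (intro mult_mono) (auto simp: power_le_one)
  moreover have "0 \<le> e * u" "0 \<le> t\<^sup>2 * e * u" using e \<open>0 \<le> u\<close> by simp_all
  ultimately have "0 \<le> 3 * e\<^sup>2 + 9 * e * u - 9 * (p\<^sup>2 * q\<^sup>2) - t * (e\<^sup>2 + 9 * e * u) + 3 * (t\<^sup>2 * e * u)"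
    by (simp add: power2_eq_square)
  then have "0 \<le> t\<^sup>2 * \<dots>" by simp
  also have "\<dots> = (1 - t)^3 * e * (e - 3 * u * t) - (e - 3 * p * t) * (e - 3 * p * (q\<^sup>2 * t))"
    unfolding e_def p_def u_def by algebra
  finally show ?thesis unfolding e_def p_def u_def by (simp add: mult.assoc)
qed

text \<open>The terms with coefficient 4 leave the constant and linear terms in \<open>t\<close>
  unchanged, so the difference is again t^2 times a factor. They add 4 e to that factor, which
  outweighs -3 e^2 and reverses the inequality.\<close>

lemma upper_telescope_poly:
  fixes q t :: real
  assumes q: "0 < q" "q \<le> 2/5" and t: "0 \<le> t" "t \<le> 1/10"
  shows "(1 - t)^3 * (1 - q^5) * (1 - q^5 - 3 * q\<^sup>2 * (1 - q) * t)
    \<le> (1 - q^5 - 3 * (1 - q^3) * t + 4 * t\<^sup>2)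
      * (1 - q^5 - 3 * (1 - q^3) * (q\<^sup>2 * t) + 4 * (q\<^sup>2 * t)\<^sup>2)"
proof -
  define e where "e = 1 - q^5"
  define p where "p = 1 - q^3"
  define u where "u = q\<^sup>2 * (1 - q)"
  have q2: "q\<^sup>2 \<le> (2/5)\<^sup>2" "q^4 \<le> (2/5)^4" "q^5 \<le> (2/5)^5" "q^5 \<le> q^3"
    using q by (intro power_mono power_decreasing; simp)+
  have e: "e \<ge> 9/10" "e \<le> 1" unfolding e_def using q q2 by (simp_all add: power_divide)
  have p: "0 \<le> p" "p \<le> 1" unfolding p_def using q by (simp_all add: power_le_one)
  have u: "0 \<le> u" unfolding u_def using q by simp
  have "u \<le> q\<^sup>2 * 1" unfolding u_def using q by (intro mult_left_mono) auto
  \<comment> \<open>This yields \<open>e * u \<le> p\<^sup>2 * q\<^sup>2\<close>, so the two terms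
    with coefficient 9 are jointly nonnegative. What remains is at least 4 e - 3 e^2 \<ge> e \<ge>
    9/10, enough to absorb the small negative terms.\<close>
  have "e * (1 - q) \<le> p * p"
  proof -
    have "p * p - e * (1 - q) = q * (1 - q\<^sup>2)\<^sup>2" unfolding e_def p_def by algebra
    also have "\<dots> \<ge> 0" using q by simp
    finally show ?thesis by simp
  qed
  then have "q\<^sup>2 * (e * (1 - q)) \<le> q\<^sup>2 * (p * p)" by (intro mult_left_mono) auto
  then have 1: "e * u \<le> p\<^sup>2 * q\<^sup>2" unfolding u_def by (simp add: power2_eq_square mult_ac)
  have 2: "e\<^sup>2 \<le> e" using e by (simp add: power2_eq_square mult_left_le)
  have "t * (p * (q\<^sup>2 + q^4)) \<le> 1/10 * (1 * ((2/5)\<^sup>2 + (2/5)^4))"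
    using t p q2 by (intro mult_mono add_mono) auto
  then have 3: "t * (p * (q\<^sup>2 + q^4)) \<le> 1/50" by (simp add: power_divide)
  have "u \<le> 1" using \<open>u \<le> q\<^sup>2 * 1\<close> q2 by (simp add: power_divide)
  then have "t\<^sup>2 * (e * u) \<le> (1/10)\<^sup>2 * (1 * 1)"
    using t u e by (intro mult_mono power_mono) auto
  then have 4: "t\<^sup>2 * (e * u) \<le> 1/100" by (simp add: power_divide)
  have "0 \<le> t * (e\<^sup>2 + 9 * (e * u))" "0 \<le> e * q^4" "0 \<le> t\<^sup>2 * q^4" using t e u by simp_all
  with 1 2 3 4 e(1) have "0 \<le> 9 * (p\<^sup>2 * q\<^sup>2) + 4 * e + 4 * (e * q^4) - 3 * e\<^sup>2 - 9 * (e * u)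
      + t * (e\<^sup>2 + 9 * (e * u)) - 12 * (t * (p * (q\<^sup>2 + q^4))) + 16 * (t\<^sup>2 * q^4) - 3 * (t\<^sup>2 * (e * u))"
    by linarith
  then have "0 \<le> t\<^sup>2 * \<dots>" by simp
  also have "\<dots> = (e - 3 * p * t + 4 * t\<^sup>2) * (e - 3 * p * (q\<^sup>2 * t) + 4 * (q\<^sup>2 * t)\<^sup>2)
      - (1 - t)^3 * e * (e - 3 * u * t)"
    unfolding e_def p_def u_def by algebra
  finally show ?thesis unfolding e_def p_def u_def by (simp add: mult.assoc)
qed

section \<open>Binet's formula and the defect of the sum\<close>

text \<open>The roots of x^2 - a x + 1 are q and 1/q, so this is G_n = (q^(-n) - q^n) / (q^(-1) - q)
  with the denominators cleared.\<close>

lemma binet: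
  fixes a :: int and G :: "nat \<Rightarrow> int" and q :: real
  assumes "G 0 = 0" and "G 1 = 1" and rec: "\<And>m. G (m + 2) = a * G (m + 1) - G m"
    and q: "q\<^sup>2 + 1 = a * q"
  shows "real_of_int (G n) * ((1 - q\<^sup>2) * q ^ n) = q * (1 - (q ^ n)\<^sup>2)"
proof (induction n rule: induct_nat_012)
  case (ge2 m)
  have G: "real_of_int (G (Suc (Suc m))) = a * G (Suc m) - G m"
    using rec[of m] by simp
  have "real_of_int (G (Suc (Suc m))) * ((1 - q\<^sup>2) * q ^ Suc (Suc m))
    = (a * q) * (G (Suc m) * ((1 - q\<^sup>2) * q ^ Suc m)) - q\<^sup>2 * (G m * ((1 - q\<^sup>2) * q ^ m))"
    unfolding G by (simp add: power2_eq_square algebra_simps)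
  also have "\<dots> = (q\<^sup>2 + 1) * (q * (1 - (q ^ Suc m)\<^sup>2)) - q\<^sup>2 * (q * (1 - (q ^ m)\<^sup>2))"
    unfolding ge2 q ..
  also have "\<dots> = q * (1 - (q ^ Suc (Suc m))\<^sup>2)" by (simp add: power2_eq_square algebra_simps)
  finally show ?case .
qed (use assms in \<open>simp_all add: mult.commute\<close>)

text \<open>The dominant Binet term of G_(n-3-5k) is q^(4-n+5k) / (1 - q^2). Summed over all k \<ge>
  0 these form a geometric series with the value of the first quotient. The defect therefore
  collects the terms beyond the cut-off, which depend on n mod 5, and the recessive Binet
  terms.\<close>

lemma defect_closed_form:
  fixes G :: "nat \<Rightarrow> int" and q :: real
  assumes "0 < q" "q < 1" and G1: "G 1 = 1"
    and binet: "\<And>n. real_of_int (G n) * ((1 - q\<^sup>2) * q ^ n) = q * (1 - (q ^ n)\<^sup>2)"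
  shows "q^4 / (q ^ n * ((1 - q\<^sup>2) * (1 - q^5)))
      - of_int (\<Sum>k = 0..\<lfloor>(real n - 4) / 5\<rfloor>. G (nat (int n - 3 - 5 * k)))
    = ((if n mod 5 = 3 then q + q^6 else if n mod 5 \<in> {2, 4} then q\<^sup>2 + q^5 else q^3 + q^4)
        - q ^ (n + 3)) / ((1 - q\<^sup>2) * (1 - q^5))"
proof -
  define \<sigma> where "\<sigma> = (\<lambda>n. \<Sum>k = 0..\<lfloor>(real n - 4) / 5\<rfloor>. G (nat (int n - 3 - 5 * k)))"
  define c where "c = (\<lambda>n::nat. if n mod 5 = 3 then q + q^6
    else if n mod 5 \<in> {2, 4} then q\<^sup>2 + q^5 else q^3 + q^4)"
  define P where "P = (1 - q\<^sup>2) * (1 - q^5)"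
  have pos: "1 - q\<^sup>2 > 0" "1 - q^5 > 0"
    using assms(1,2) by (simp_all add: power_less_one_iff)
  have "P > 0" unfolding P_def using pos by simp
  have "q^4 / (q ^ n * P) - \<sigma> n = (c n - q ^ (n + 3)) / P"
  proof (induction n rule: less_induct)
    case (less n)
    show ?case
    proof (cases "n < 5")
      case True
      show ?thesis
      \<comment> \<open>Among the base cases only \<open>n = 4\<close> has a nonempty sum, namely
        the single summand \<open>G 1\<close>.\<close>
      proof (cases "n = 4")
        case True
        have "\<sigma> 4 = 1" unfolding \<sigma>_def using G1 by simp
        moreover have "q^4 / (q ^ 4 * P) - 1 = (1 - P) / P"
          using \<open>P > 0\<close> assms(1) by (simp add: field_simps)
        moreover have "1 - P = q\<^sup>2 + q^5 - q^7" unfolding P_def by algebra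
        ultimately show ?thesis using True by (simp add: c_def)
      next
        case False
        with \<open>n < 5\<close> have n: "n = 0 \<or> n = 1 \<or> n = 2 \<or> n = 3" by linarith
        then have "\<lfloor>(real n - 4) / 5\<rfloor> = - 1" by (auto simp: floor_eq_iff)
        then have "\<sigma> n = 0" unfolding \<sigma>_def by simp
        moreover have "q^4 = q ^ n * (c n - q ^ (n + 3))"
          using n by (auto simp: c_def algebra_simps simp flip: power_add power_Suc)
        then have "q^4 / (q ^ n * P) = (c n - q ^ (n + 3)) / P"
          using assms(1) by simp
        ultimately show ?thesis by simp
      qed
    next
      case False
      define m where "m = n - 5"
      have n: "n = m + 5" using False by (simp add: m_def)
      define b where "b = 1 - q\<^sup>2"
      define e where "e = 1 - q^5"
      define z where "z = q ^ m"
      have be: "b > 0" "e > 0" "z > 0" "P = b * e"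
        using pos assms(1) by (simp_all add: b_def e_def z_def P_def)
      \<comment> \<open>The two Binet terms of \<open>G (m + 2)\<close> are matched separately: the
        dominant one is the increment of the geometric quotient, and the recessive one comes from
        the change of \<open>q ^ (n + 3)\<close>. In both, the factor \<open>e\<close> of
        \<open>P\<close> cancels.\<close>
      have "q^4 / (z * P) + 1 / (q * z * b) = (q^5 + e) / (q * z * P)"
        unfolding be(4) using be(1-3) assms(1) by (simp add: divide_simps power_Suc[symmetric] mult_ac)
      also have "\<dots> = q^4 / (q ^ (m + 5) * P)"
        using assms(1) be(3) by (simp add: e_def z_def power_add divide_simps eval_nat_numeral)
      finally have "q^4 / (q ^ (m + 5) * P) = q^4 / (z * P) + 1 / (q * z * b)" by simp
      moreover have "q ^ (m + 3) - q ^ (m + 8) = q^3 * z * e"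
        by (simp add: e_def z_def algebra_simps power_add eval_nat_numeral)
      then have "(q ^ (m + 3) - q ^ (m + 8)) / P = q^3 * z / b"
        unfolding be(4) using be(2) by simp
      moreover have "G (m + 2) * (b * (z * q\<^sup>2)) = q * (1 - (z * q\<^sup>2)\<^sup>2)"
        using binet[of "m + 2"] unfolding b_def z_def power_add .
      then have "q * (G (m + 2) * (b * (z * q))) = q * (1 - (z * q\<^sup>2)\<^sup>2)"
        by (simp add: power2_eq_square mult_ac)
      then have "G (m + 2) * (b * (z * q)) = 1 - (z * q\<^sup>2)\<^sup>2"
        using assms(1) by simp
      then have "G (m + 2) = 1 / (q * z * b) - q^3 * z / b"
        using be assms(1) by (simp add: field_simps eval_nat_numeral)
      moreover have "\<sigma> n = \<sigma> m + G (m + 2)"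
        unfolding n \<sigma>_def by (rule step_sum_add5)
      moreover have "c n = c m" unfolding n c_def by simp
      ultimately show ?thesis
        using less[of m] n by (simp add: diff_divide_distrib z_def add.commute[of m])
    qed
  qed
  then show ?thesis unfolding P_def \<sigma>_def c_def .
qed

section \<open>Explicit approximations of the tail\<close>

text \<open>In terms of \<open>t = q\<^sup>2\<^sup>n\<close>, the series for the tail has reciprocal proportional to
  \<open>1 - q^5 - 3 (1 - q^3) t + c t\<^sup>2 + O(t\<^sup>3)\<close> with \<open>2 < c < 3\<close>. The value \<open>c = 0\<close> makes the
  approximation an upper bound of the tail, and \<open>c = 4\<close> a lower bound.\<close>

definition tail_approx :: "real \<Rightarrow> real \<Rightarrow> nat \<Rightarrow> real" where
  "tail_approx c q n = (q ^ n * (1 - q\<^sup>2) / q) ^ 3 * (1 - q^5)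
    / ((1 - q^3) * (1 - q^5 - 3 * (1 - q^3) * (q ^ n)\<^sup>2 + c * (q ^ n) ^ 4))"

lemma tail_approx_tendsto_0:
  assumes "0 < q" "q < 1"
  shows "(\<lambda>k. tail_approx c q (n + k)) \<longlonglongrightarrow> 0"
proof -
  have *: "(\<lambda>k. q ^ (n + k)) \<longlonglongrightarrow> 0"
    using LIMSEQ_ignore_initial_segment[OF LIMSEQ_realpow_zero, of q n] assms by (simp add: add.commute)
  have "q^3 < 1" "q^5 < 1" using assms by (simp_all add: power_less_one_iff)
  then show ?thesis unfolding tail_approx_def
    using assms by (auto intro!: tendsto_eq_intros *)
qed

text \<open>Here \<open>g\<close> stands for G_k. With t = q^(2k), the denominators contribute C(t)
  and C(q^2 t), and 1/g^3 is \<open>m / (1 - t) ^ 3\<close>. Clearing denominators reduces both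
  claims to the two polynomial inequalities. The bound on \<open>t\<close> keeps the denominators
  positive.\<close>

lemma tail_approx_diff:
  fixes q g :: real
  assumes q: "0 < q" "q \<le> 2/5" and t: "(q ^ k)\<^sup>2 \<le> 1/10"
    and g: "g * ((1 - q\<^sup>2) * q ^ k) = q * (1 - (q ^ k)\<^sup>2)"
  shows "1 / g ^ 3 \<le> tail_approx 0 q k - tail_approx 0 q (Suc k)"
    and "tail_approx 4 q k - tail_approx 4 q (Suc k) \<le> 1 / g ^ 3"
proof -
  define s where "s = q ^ k"
  define t where "t = s\<^sup>2"
  define e where "e = 1 - q^5"
  define p where "p = 1 - q^3"
  define u where "u = q\<^sup>2 * (1 - q)"
  define m where "m = (s * (1 - q\<^sup>2) / q) ^ 3"
  define C where "C = (\<lambda>c x. e - 3 * p * x + c * x\<^sup>2)"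
  have q2: "q\<^sup>2 \<le> (2/5)\<^sup>2" "q^5 \<le> (2/5)^5" "q^3 \<le> (2/5)^3"
    using q by (intro power_mono; simp)+
  have t: "0 \<le> t" "t \<le> 1/10" using t by (simp_all add: t_def s_def)
  have e: "e \<ge> 9/10" "e \<le> 1" unfolding e_def using q q2 by (simp_all add: power_divide)
  have p: "0 < p" "p \<le> 1" unfolding p_def using q q2 by (simp_all add: power_divide)
  have s: "s > 0" unfolding s_def using q by simp
  have q2': "1 - q\<^sup>2 > 0" using q2 by (simp add: power_divide)
  have m: "m > 0" unfolding m_def using s q q2' by simp
  have qt: "0 \<le> q\<^sup>2 * t" "q\<^sup>2 * t \<le> 1/10"
    using t q mult_mono[of "q\<^sup>2" 1 t "1/10"] by (simp_all add: power_le_one)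
  have C: "C c x > 0" if "c \<ge> 0" "0 \<le> x" "x \<le> 1/10" for c x
  proof -
    have "p * x \<le> 1 * (1/10)" using p that by (intro mult_mono) auto
    moreover have "0 \<le> c * x\<^sup>2" using that by simp
    ultimately show ?thesis using e unfolding C_def by linarith
  qed
  have "g = q * (1 - t) / ((1 - q\<^sup>2) * s)"
    using g s q2' unfolding t_def s_def[symmetric] by (simp add: field_simps)
  then have g: "1 / g ^ 3 = m / (1 - t) ^ 3"
    unfolding m_def by (simp add: power_divide power_mult_distrib mult.commute)
  have k: "tail_approx c q k = m * e / (p * C c t)" for c
    unfolding tail_approx_def m_def C_def e_def p_def t_def s_def by simp
  have q2t: "(q ^ Suc k)\<^sup>2 = q\<^sup>2 * t" "(q ^ Suc k) ^ 4 = (q\<^sup>2 * t)\<^sup>2"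
    unfolding t_def s_def by (simp_all add: power_mult_distrib)
  \<comment> \<open>Passing to the next index multiplies \<open>m\<close> by q^3 and
    \<open>t\<close> by q^2.\<close>
  have Sk: "tail_approx c q (Suc k) = q^3 * m * e / (p * C c (q\<^sup>2 * t))" for c
    unfolding tail_approx_def q2t m_def C_def e_def p_def s_def
    by (simp add: power_mult_distrib power_divide mult_ac)
  have diff: "tail_approx c q k - tail_approx c q (Suc k)
      = m * e * (C c (q\<^sup>2 * t) - q^3 * C c t) / p / (C c t * C c (q\<^sup>2 * t))" if "c \<ge> 0" for c
    unfolding k Sk using C[OF that t] C[OF that qt] p by (simp add: field_simps)
  have t1: "(1 - t) ^ 3 > 0" using t by simp
  \<comment> \<open>The factor \<open>p\<close> splits off exactly and cancels against the
    \<open>p\<close> in the denominator of \<open>tail_approx\<close>.\<close>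
  have C0: "C 0 (q\<^sup>2 * t) - q^3 * C 0 t = p * (e - 3 * u * t)"
    unfolding C_def e_def u_def p_def by algebra
  \<comment> \<open>For \<open>c = 4\<close> an extra term remains, but it only lowers the
    difference and may be dropped in a bound from above.\<close>
  have "C 4 (q\<^sup>2 * t) - q^3 * C 4 t = p * (e - 3 * u * t) - 4 * t\<^sup>2 * (q^3 * (1 - q))"
    unfolding C_def e_def u_def p_def by algebra
  also have "\<dots> \<le> p * (e - 3 * u * t)" using q by simp
  finally have C4: "(C 4 (q\<^sup>2 * t) - q^3 * C 4 t) / p \<le> e - 3 * u * t"
    using p by (simp add: field_simps)
  have "C 0 t * C 0 (q\<^sup>2 * t) \<le> (1 - t) ^ 3 * (e * (e - 3 * u * t))"
    using lower_telescope_poly[OF q t] unfolding C_def e_def p_def u_def by (simp add: mult.assoc)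
  then have "m * (C 0 t * C 0 (q\<^sup>2 * t)) \<le> m * ((1 - t) ^ 3 * (e * (e - 3 * u * t)))"
    using m by simp
  then have "m / (1 - t) ^ 3 \<le> m * e * (e - 3 * u * t) / (C 0 t * C 0 (q\<^sup>2 * t))"
    using C[OF _ t, of 0] C[OF _ qt, of 0] t1 by (simp add: pos_le_divide_eq pos_divide_le_eq mult_ac)
  then show "1 / g ^ 3 \<le> tail_approx 0 q k - tail_approx 0 q (Suc k)"
    using p by (simp add: g diff C0)
  have "(1 - t) ^ 3 * (e * (e - 3 * u * t)) \<le> C 4 t * C 4 (q\<^sup>2 * t)"
    using upper_telescope_poly[OF q t] unfolding C_def e_def p_def u_def by (simp add: mult.assoc)
  then have "m * ((1 - t) ^ 3 * (e * (e - 3 * u * t))) \<le> m * (C 4 t * C 4 (q\<^sup>2 * t))"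
    using m by simp
  then have *: "m * e * (e - 3 * u * t) / (C 4 t * C 4 (q\<^sup>2 * t)) \<le> m / (1 - t) ^ 3"
    using C[OF _ t, of 4] C[OF _ qt, of 4] t1 by (simp add: pos_le_divide_eq pos_divide_le_eq mult_ac)
  have "m * e * ((C 4 (q\<^sup>2 * t) - q^3 * C 4 t) / p) / (C 4 t * C 4 (q\<^sup>2 * t))
      \<le> m * e * (e - 3 * u * t) / (C 4 t * C 4 (q\<^sup>2 * t))"
    using C[OF _ t, of 4] C[OF _ qt, of 4] m e C4 by (intro divide_right_mono mult_left_mono) auto
  with * show "tail_approx 4 q k - tail_approx 4 q (Suc k) \<le> 1 / g ^ 3"
    by (simp add: g diff)
qed

text \<open>Here \<open>x\<close> and \<open>y\<close> stand for G_n and G_(n-1). After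
  multiplication by \<open>M\<close>, the reciprocal and x^3 - y^3 - 3h agree in their constant and
  linear terms in \<open>t\<close>. The remainder is t^2 times a bounded factor, and t^2 is of order
  \<open>s * M\<close>, which gives the error q^n.\<close>

lemma inverse_tail_approx:
  fixes q x y :: real
  assumes q: "0 < q" "q \<le> 2/5" and n: "n \<ge> 2"
    and x: "x * ((1 - q\<^sup>2) * q ^ n) = q * (1 - (q ^ n)\<^sup>2)"
    and y: "y * ((1 - q\<^sup>2) * q ^ (n - 1)) = q * (1 - (q ^ (n - 1))\<^sup>2)"
  defines "h \<equiv> q^4 / (q ^ n * ((1 - q\<^sup>2) * (1 - q^5)))"
  shows "x^3 - y^3 - 3 * h \<le> inverse (tail_approx 0 q n)"
    and "inverse (tail_approx 4 q n) \<le> x^3 - y^3 - 3 * h + q ^ n"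
    and "0 < tail_approx 0 q n" and "0 < tail_approx 4 q n"
proof -
  define s where "s = q ^ n"
  define t where "t = s\<^sup>2"
  define e where "e = 1 - q^5"
  define p where "p = 1 - q^3"
  define M where "M = s^3 * (1 - q\<^sup>2)^3 * e"
  define C where "C = (\<lambda>c. e - 3 * p * t + c * t\<^sup>2)"
  have q2: "q\<^sup>2 \<le> (2/5)\<^sup>2" "q^5 \<le> (2/5)^5" "q^3 \<le> (2/5)^3"
    using q by (intro power_mono; simp)+
  have e: "e \<ge> 9/10" "e \<le> 1" unfolding e_def using q q2 by (simp_all add: power_divide)
  have p: "0 < p" "p \<le> 1" unfolding p_def using q q2 by (simp_all add: power_divide)
  have s: "s > 0" unfolding s_def using q by simp
  have q2': "1 - q\<^sup>2 > 0" using q2 by (simp add: power_divide)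
  have M: "M > 0" unfolding M_def using s e q2' by simp
  have "s \<le> q\<^sup>2" unfolding s_def using q n by (intro power_decreasing) auto
  then have "t \<le> q\<^sup>2 * q\<^sup>2" unfolding t_def power2_eq_square[of s] using s by (intro mult_mono) auto
  also have "\<dots> \<le> 1 * q\<^sup>2" using q by (intro mult_right_mono) (auto simp: power_le_one)
  finally have tq: "t \<le> q\<^sup>2" by simp
  have "q\<^sup>2 * q\<^sup>2 \<le> (2/5)\<^sup>2 * (2/5)\<^sup>2" using q2 by (intro mult_mono) auto
  with \<open>t \<le> q\<^sup>2 * q\<^sup>2\<close> have t: "0 \<le> t" "t \<le> 1/10" by (simp_all add: t_def power_divide)
  have C: "C c > 0" if "c \<ge> 0" for c
  proof -
    have "p * t \<le> 1 * (1/10)" using p t by (intro mult_mono) auto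
    moreover have "0 \<le> c * t\<^sup>2" using that by simp
    ultimately show ?thesis using e unfolding C_def by linarith
  qed
  have ta: "tail_approx c q n = M / (q^3 * p * C c)" for c
    unfolding tail_approx_def C_def M_def e_def p_def t_def s_def
    by (simp add: power_divide power_mult_distrib mult_ac)
  show "0 < tail_approx 0 q n" "0 < tail_approx 4 q n"
    unfolding ta using M q p C[of 0] C[of 4] by simp_all
  have x': "x = q * (1 - t) / ((1 - q\<^sup>2) * s)"
    using x s q2' unfolding t_def s_def[symmetric] by (simp add: field_simps)
  have sn: "s = q * q ^ (n - 1)" unfolding s_def using n by (simp flip: power_Suc)
  have "y * ((1 - q\<^sup>2) * s) = q\<^sup>2 - t"
  proof -
    have "q * (y * ((1 - q\<^sup>2) * s)) = q * (q * (y * ((1 - q\<^sup>2) * q ^ (n - 1))))"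
      unfolding sn by simp
    also have "\<dots> = q * (q\<^sup>2 - t)"
      unfolding y t_def sn using q by (simp add: power2_eq_square algebra_simps)
    finally show ?thesis using q by simp
  qed
  then have y': "y = (q\<^sup>2 - t) / ((1 - q\<^sup>2) * s)"
    using s q2' by (simp add: field_simps)
  have h: "3 * h * M = 3 * q^4 * t * (1 - q\<^sup>2)\<^sup>2"
  proof -
    have "b^3 = b * b\<^sup>2" for b :: real by (simp add: power3_eq_cube power2_eq_square)
    then show ?thesis
      unfolding h_def M_def t_def s_def[symmetric] e_def[symmetric] using s e q2' by simp
  qed
  have "x^3 * M = q^3 * (1 - t)^3 * e" "y^3 * M = (q\<^sup>2 - t)^3 * e"
    unfolding x' y' M_def using s e q2' by (simp_all add: power_divide power_mult_distrib)
  then have A: "(x^3 - y^3 - 3 * h) * M = q^3 * (1 - t)^3 * e - (q\<^sup>2 - t)^3 * e - 3 * q^4 * t * (1 - q\<^sup>2)\<^sup>2"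
    unfolding left_diff_distrib h by simp
  have diff: "q^3 * p * C c - (x^3 - y^3 - 3 * h) * M
      = t\<^sup>2 * (c * q^3 * p + 3 * q\<^sup>2 * (1 - q) * e - e * p * t)" for c
    unfolding A C_def e_def p_def by algebra
  have inv: "inverse (tail_approx c q n) * M = q^3 * p * C c" for c
    unfolding ta using M by simp
  \<comment> \<open>This makes the one negative term of the remainder harmless when
    \<open>c = 0\<close>.\<close>
  have "p * t \<le> 3 * (1 - q) * q\<^sup>2"
  proof -
    have "p = (1 - q) * (1 + q + q\<^sup>2)" unfolding p_def by algebra
    also have "\<dots> \<le> (1 - q) * 3" using q q2 by (intro mult_left_mono) (auto simp: power_divide)
    finally have "p \<le> 3 * (1 - q)" by simp
    then show ?thesis using tq t q by (intro mult_mono) auto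
  qed
  then have "e * (p * t) \<le> e * (3 * (1 - q) * q\<^sup>2)" using e by (intro mult_left_mono) auto
  then have "e * p * t \<le> 3 * q\<^sup>2 * (1 - q) * e" by (simp only: mult_ac)
  then have "0 \<le> t\<^sup>2 * (0 * q^3 * p + 3 * q\<^sup>2 * (1 - q) * e - e * p * t)"
    by (intro mult_nonneg_nonneg) simp_all
  then have "(x^3 - y^3 - 3 * h) * M \<le> inverse (tail_approx 0 q n) * M"
    using diff[of 0] inv[of 0] by linarith
  then show "x^3 - y^3 - 3 * h \<le> inverse (tail_approx 0 q n)" using M by simp
  have "4 * q^3 * p + 3 * q\<^sup>2 * (1 - q) * e \<le> (1 - q\<^sup>2)^3 * e"
  proof -
    have "q^3 * p \<le> (2/5)^3 * 1" using p q2 q by (intro mult_mono) auto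
    then have "q^3 * p \<le> 8/125" by (simp add: power_divide)
    \<comment> \<open>The bound is the value at q = 2/5, so 2/5 - q is a factor of the
      difference.\<close>
    moreover have "q\<^sup>2 * (1 - q) \<le> 12/125"
    proof -
      have "q * (3/5 - q) \<ge> 0" using q by (intro mult_nonneg_nonneg) auto
      then have "0 \<le> (2/5 - q) * (6/25 + q * (3/5 - q))" 
        using q by (intro mult_nonneg_nonneg) auto
      also have "\<dots> = 12/125 - q\<^sup>2 * (1 - q)" by (simp add: power2_eq_square field_simps)
      finally show ?thesis by simp
    qed
    then have "q\<^sup>2 * (1 - q) * e \<le> 12/125 * e" using e by (intro mult_right_mono) auto
    moreover have "(21/25)^3 \<le> (1 - q\<^sup>2)^3" using q2 by (intro power_mono) (auto simp: power_divide)
    then have "(21/25)^3 * e \<le> (1 - q\<^sup>2)^3 * e" using e by (intro mult_right_mono) auto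
    then have "9261/15625 * e \<le> (1 - q\<^sup>2)^3 * e" by (simp add: power_divide)
    ultimately have "4 * (q^3 * p) + 3 * (q\<^sup>2 * (1 - q) * e) \<le> (1 - q\<^sup>2)^3 * e"
      using e by linarith
    then show ?thesis by (simp only: mult.assoc)
  qed
  moreover have "0 \<le> e * p * t" using e p t by simp
  ultimately have "t\<^sup>2 * (4 * q^3 * p + 3 * q\<^sup>2 * (1 - q) * e - e * p * t) \<le> t\<^sup>2 * ((1 - q\<^sup>2)^3 * e)"
    by (intro mult_left_mono) auto
  also have "\<dots> = s * M" unfolding M_def t_def by (simp add: power2_eq_square power3_eq_cube)
  finally have "inverse (tail_approx 4 q n) * M \<le> (x^3 - y^3 - 3 * h + s) * M"
    using diff[of 4] inv[of 4] by (simp add: distrib_right)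
  then show "inverse (tail_approx 4 q n) \<le> x^3 - y^3 - 3 * h + q ^ n"
    using M by (simp add: s_def)
qed

section \<open>The characteristic root and the size of the defect\<close>

text \<open>The intermediate value theorem for a x - x^2 at level 1 yields the smaller root. The
  constants enclose (3 - sqrt 5)/2 = 0.3819... for a = 3, and 27/100 lies just above 2 - sqrt 3 =
  0.2679..., the root for a = 4.\<close>

lemma characteristic_root:
  fixes a :: int
  assumes "a \<ge> 3"
  obtains q :: real where "0 < q" "q \<le> 2/5" "q\<^sup>2 + 1 = a * q"
    "a = 3 \<Longrightarrow> 19/50 \<le> q" "a \<noteq> 3 \<Longrightarrow> q \<le> 27/100"
proof -
  define b where "b = (if a = 3 then 2/5 else 27/100 :: real)"
  define f where "f = (\<lambda>x::real. a * x - x\<^sup>2)"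
  have a: "real_of_int a \<ge> (if a = 3 then 3 else 4)" using assms by auto
  define c where "c = (if a = 3 then 19/50 else 0 :: real)"
  have "f c \<le> 1" by (simp add: f_def c_def power2_eq_square)
  moreover have "1 \<le> f b" using a by (simp add: f_def b_def power2_eq_square split: if_splits)
  moreover have "c \<le> b" by (simp add: b_def c_def)
  moreover have "continuous_on {c..b} f" unfolding f_def by (intro continuous_intros)
  ultimately obtain q where q: "c \<le> q" "q \<le> b" "f q = 1" using IVT'[of f c 1 b] by blast
  show thesis
  proof (rule that[of q])
    have "q \<noteq> 0" using q(3) by (auto simp: f_def)
    then show "0 < q" using q(1) by (simp add: c_def split: if_splits)
  qed (use q in \<open>auto simp: b_def c_def f_def split: if_splits\<close>)
qed

text \<open>These bounds fix the floor of any number between N - 3d and N - 3d + q^n with N an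
  integer. The leading power in the numerator is q, q^2 or q^3 according to n mod 5. Only q itself
  can push 3d beyond 1, and it does so at q near 0.38.\<close>

lemma defect_bounds:
  fixes q :: real
  assumes q: "0 < q" "q \<le> 2/5" and n: "n \<ge> 2"
  defines "d \<equiv> ((if n mod 5 = 3 then q + q^6 else if n mod 5 \<in> {2, 4} then q\<^sup>2 + q^5 else q^3 + q^4)
        - q ^ (n + 3)) / ((1 - q\<^sup>2) * (1 - q^5))"
  shows "q ^ n < 3 * d" and "3 * d \<le> 2"
    and "n mod 5 \<noteq> 3 \<or> q \<le> 27/100 \<Longrightarrow> 3 * d \<le> 1"
    and "n mod 5 = 3 \<Longrightarrow> 19/50 \<le> q \<Longrightarrow> 1 + q ^ n < 3 * d"
proof -
  define c where "c = (if n mod 5 = 3 then q + q^6 else if n mod 5 \<in> {2, 4} then q\<^sup>2 + q^5 else q^3 + q^4)"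
  define P where "P = (1 - q\<^sup>2) * (1 - q^5)"
  have b: "q ^ k \<le> (2/5) ^ k" for k using q by (intro power_mono) auto
  have b': "(21/25) * (49/50) \<le> P"
    unfolding P_def using b[of 2] b[of 5] by (intro mult_mono) (auto simp: power_divide)
  have P1: "P \<le> 1 - q\<^sup>2"
    unfolding P_def using q by (intro mult_left_le) (auto simp: power_le_one)
  have P: "P > 0" using b' by simp
  have d: "3 * d = 3 * (c - q ^ (n + 3)) / P" unfolding d_def c_def P_def by simp
  have low: "r < 3 * d \<longleftrightarrow> r * P + 3 * (q^n * q^3) < 3 * c" for r
    using P unfolding d by (simp add: field_simps power_add)
  have up: "3 * d \<le> r" if "3 * c \<le> r * P" for r
  proof -
    have "3 * (c - q ^ (n + 3)) \<le> 3 * c" using q by simp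
    also note that
    finally have "3 * (c - q ^ (n + 3)) \<le> r * P" .
    then show ?thesis unfolding d using P by (simp add: field_simps)
  qed
  have pw: "0 < q ^ k" for k using q by simp
  have q3: "q^3 \<le> 8/125" using b[of 3] by (simp add: power_divide)
  have "P + 3 * q^3 \<le> 2"
    using P1 q3 zero_le_power2[of q] by linarith
  then have "q ^ n * (P + 3 * q^3) \<le> q ^ n * 2"
    using pw[of n] by simp
  then have 1: "q ^ n * P + 3 * (q ^ n * q^3) \<le> 2 * q ^ n" by (simp add: algebra_simps)
  have dec: "q ^ n \<le> q ^ k" if "k \<le> n" for k
    using q that by (intro power_decreasing) auto
  \<comment> \<open>By \<open>low\<close> and \<open>1\<close> this suffices for the lower bound. In
    each residue class the leading exponent of \<open>c\<close> is at most \<open>n\<close>, so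
    \<open>c\<close> exceeds q^n.\<close>
  have "2 * q ^ n < 3 * c"
  proof -
    consider "n mod 5 = 3" | "n mod 5 \<in> {2, 4}" | "n mod 5 \<noteq> 3" "n mod 5 \<notin> {2, 4}" by blast
    then show ?thesis
    proof cases
      case 1
      then have "c = q + q^6" by (simp add: c_def)
      then show ?thesis using dec[of 1] n pw[of 6] q unfolding power_one_right by linarith
    next
      case 2
      then have "c = q\<^sup>2 + q^5" by (auto simp: c_def)
      then show ?thesis using dec[of 2] n pw[of 5] pw[of 2] by linarith
    next
      case 3
      then have "n \<ge> 3" using n by (cases "n = 2") auto
      moreover have "c = q^3 + q^4" using 3 by (auto simp: c_def)
      ultimately show ?thesis using dec[of 3] pw[of 3] pw[of 4] by linarith
    qed
  qed
  then show "q ^ n < 3 * d" unfolding low using 1 by linarith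
  have c_le: "c \<le> q + q^6" if "n mod 5 = 3" using that by (simp add: c_def)
  have c_le': "c \<le> q\<^sup>2 + q^3" if "n mod 5 \<noteq> 3"
  proof -
    have "q^5 \<le> q^3" "q^3 \<le> q\<^sup>2" "q^4 \<le> q^3" using q by (intro power_decreasing; simp)+
    then show ?thesis using that by (auto simp: c_def)
  qed
  show "3 * d \<le> 1" if "n mod 5 \<noteq> 3 \<or> q \<le> 27/100"
  proof (cases "n mod 5 = 3")
    case True
    then have "q \<le> 27/100" using that by simp
    then have bb: "q ^ k \<le> (27/100) ^ k" for k using q by (intro power_mono) auto
    have "(9/10) * (99/100) \<le> P"
      unfolding P_def using bb[of 2] bb[of 5] by (intro mult_mono) (auto simp: power_divide)
    then show ?thesis using up[of 1] c_le[OF True] bb[of 6] \<open>q \<le> 27/100\<close> by (simp add: power_divide)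
  next
    case False
    then show ?thesis using up[of 1] c_le' b[of 2] b[of 3] b' by (simp add: power_divide)
  qed
  show "3 * d \<le> 2"
    using up[of 2] c_le c_le' b[of 2] b[of 3] b[of 6] b' q by (cases "n mod 5 = 3") (simp_all add: power_divide)
  show "1 + q ^ n < 3 * d" if "n mod 5 = 3" "19/50 \<le> q"
  proof -
    have "n \<ge> 3" using that n by (cases "n = 2") auto
    then have "q ^ n \<le> 8/125" using dec[of 3] q3 by linarith
    moreover have "(19/50)\<^sup>2 \<le> q\<^sup>2" using that by (intro power_mono) auto
    then have "361/2500 \<le> q\<^sup>2" by (simp add: power_divide)
    moreover have "c = q + q^6" using that by (simp add: c_def)
    moreover have "(1 + q ^ n) * P = P + q ^ n * P" by (simp add: distrib_right)
    \<comment> \<open>Numerically, P + 2 q^n \<le> 1 - 361/2500 + 16/125 < 1, whereas 3c > 3 * 19/50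
      > 1.\<close>
    ultimately show ?thesis unfolding low using 1 P1 pw[of 6] that(2) by linarith
  qed
qed

section \<open>The floor of the reciprocal tail\<close>

theorem theorem1p1:
  fixes a :: int and G :: "nat \<Rightarrow> int" and n :: nat
  assumes a: "a \<ge> 3"
    and G_0: "G 0 = 0"
    and G_1: "G 1 = 1"
    and G_rec: "\<And>m. G (m + 2) = a * G (m + 1) - G m"
    and n: "n \<ge> 2"
  shows "summable (\<lambda>k. 1 / real_of_int (G (n + k)) ^ 3) \<and>
    \<lfloor>inverse (\<Sum>k. 1 / real_of_int (G (n + k)) ^ 3)\<rfloor> =
      (if a = 3 \<and> n mod 5 = 3
       then G n ^ 3 - G (n - 1) ^ 3
              - 3 * (\<Sum>k = 0..\<lfloor>(real n - 4) / 5\<rfloor>. G (nat (int n - 3 - 5 * k))) - 2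
       else G n ^ 3 - G (n - 1) ^ 3
              - 3 * (\<Sum>k = 0..\<lfloor>(real n - 4) / 5\<rfloor>. G (nat (int n - 3 - 5 * k))) - 1)"
proof -
  define \<sigma> where "\<sigma> = (\<Sum>k = 0..\<lfloor>(real n - 4) / 5\<rfloor>. G (nat (int n - 3 - 5 * k)))"
  define f where "f = (\<lambda>k. 1 / real_of_int (G (n + k)) ^ 3)"
  obtain q :: real where q: "0 < q" "q \<le> 2/5" "q\<^sup>2 + 1 = a * q"
    and qa: "a = 3 \<Longrightarrow> 19/50 \<le> q" "a \<noteq> 3 \<Longrightarrow> q \<le> 27/100"
    using characteristic_root[OF a] by blast
  have G: "real_of_int (G k) * ((1 - q\<^sup>2) * q ^ k) = q * (1 - (q ^ k)\<^sup>2)" for k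
    using binet[OF G_0 G_1 G_rec q(3)] .
  have small: "(q ^ (n + k))\<^sup>2 \<le> 1/10" for k
  proof -
    have "(q ^ (n + k))\<^sup>2 \<le> q ^ 4"
      unfolding power_mult[symmetric] using q n by (intro power_decreasing) auto
    also have "\<dots> \<le> (2/5) ^ 4" using q by (intro power_mono) auto
    finally show ?thesis by (simp add: power_divide)
  qed
  have f: "f k \<le> tail_approx 0 q (n + k) - tail_approx 0 q (n + Suc k)"
    "tail_approx 4 q (n + k) - tail_approx 4 q (n + Suc k) \<le> f k" for k
    unfolding f_def using tail_approx_diff[OF q(1,2) small G] by simp_all
  have "0 \<le> f k" for k
  proof -
    have "real_of_int (G (n + k)) * ((1 - q\<^sup>2) * q ^ (n + k)) \<ge> 0"
      unfolding G using q by (intro mult_nonneg_nonneg) (auto simp: power_le_one)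
    moreover have "(1 - q\<^sup>2) * q ^ (n + k) > 0" using q by (simp add: power_less_one_iff)
    ultimately have "real_of_int (G (n + k)) \<ge> 0" by (simp add: zero_le_mult_iff)
    then show ?thesis unfolding f_def by simp
  qed
  then have upper: "summable f" "suminf f \<le> tail_approx 0 q n"
    using suminf_le_telescope[of f "\<lambda>k. tail_approx 0 q (n + k)"] f(1) tail_approx_tendsto_0 q by simp_all
  have lower: "tail_approx 4 q n \<le> suminf f"
    using telescope_le_suminf[of f "\<lambda>k. tail_approx 4 q (n + k)"] upper f(2) tail_approx_tendsto_0 q by simp
  note ta = inverse_tail_approx[OF q(1,2) n G G]
  define d where "d = q^4 / (q ^ n * ((1 - q\<^sup>2) * (1 - q^5))) - \<sigma>"
  define N where "N = G n ^ 3 - G (n - 1) ^ 3 - 3 * \<sigma>"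
  \<comment> \<open>The lower approximation is positive, hence so is the series, and taking
    reciprocals reverses the order.\<close>
  have "inverse (tail_approx 0 q n) \<le> inverse (suminf f)"
    using upper lower ta(4) by (intro le_imp_inverse_le) auto
  with ta(1) have lo: "N - 3 * d \<le> inverse (suminf f)"
    by (simp add: N_def d_def)
  have "inverse (suminf f) \<le> inverse (tail_approx 4 q n)"
    using lower ta(4) by (rule le_imp_inverse_le)
  with ta(2) have up: "inverse (suminf f) \<le> N - 3 * d + q ^ n"
    by (simp add: N_def d_def)
  have d: "d = ((if n mod 5 = 3 then q + q^6 else if n mod 5 \<in> {2, 4} then q\<^sup>2 + q^5 else q^3 + q^4)
        - q ^ (n + 3)) / ((1 - q\<^sup>2) * (1 - q^5))"
    unfolding d_def \<sigma>_def using q by (intro defect_closed_form[OF _ _ G_1 G]) auto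
  note db = defect_bounds[OF q(1,2) n, folded d]
  \<comment> \<open>The reciprocal lies between N - 3d and N - 3d + q^n. From q^n < 3d \<le> 1 the
    floor is N - 1; from 1 + q^n < 3d \<le> 2 it is N - 2. For n = 3 mod 5 the choice between the
    two rests on whether a = 3, through the bounds on \<open>q\<close>.\<close>
  have "\<lfloor>inverse (suminf f)\<rfloor> = (if a = 3 \<and> n mod 5 = 3 then N - 2 else N - 1)"
  proof (cases "a = 3 \<and> n mod 5 = 3")
    case True
    with lo up db(2,4) qa show ?thesis by (simp add: floor_eq_iff)
  next
    case False
    with lo up db(1,3) qa show ?thesis by (auto simp: floor_eq_iff)
  qed
  with upper(1) show ?thesis unfolding f_def N_def \<sigma>_def by simp
qed

end
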